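(* Let $m\in\mathbb N$, $r\ge2$, $\boldsymbol\alpha\in\mathbb N_0^r$, and $h\le1-\lceil\log_2r\rceil\cdot2^{-m}$. With $\mathcal H_m$ the hierarchical network and $\boldsymbol\ell_{\mathbf x\mid\boldsymbol\alpha}$ the vector defined in the context, the following hold: 1. $0\le\mathcal H_m(\boldsymbol\ell_{\mathbf x\mid\boldsymbol\alpha})\le1$ uniformly on $\mathbf x\in[0,h]^r$; 2. $0\le\mathcal H_m(\boldsymbol\ell_{\mathbf x\mid\boldsymbol\alpha})-\mathbf x^{\boldsymbol\alpha}\le3^{\lceil\log_2r\rceil-1}2^{-m}$ uniformly on $\mathbf x\in[0,h]^r$; 3. for every $i\in\{1,\dots,r\}$, $\sup_{\mathbf x\in[0,h]^r}\bigl|\frac{\partial}{\partial x_i}[\mathcal H_m(\boldsymbol\ell_{\mathbf x\mid\boldsymbol\alpha})-\mathbf x^{\boldsymbol\alpha}]\bigr|\le3^{\lceil\log_2r\rceil-1}\cdot\|\boldsymbol\alpha\|_1\cdot2^{-m}$.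
   Context: Notation: $[n]=\{1,\dots,n\}$, $\mathbb N_0=\{0\}\cup\mathbb N$, $\mathbf 1_n$ is the $n$-vector of ones, $\|\boldsymbol\alpha\|_1=\sum_i|\alpha_i|$, $\mathbf x^{\boldsymbol\alpha}=\prod_{i=1}^rx_i^{\alpha_i}$ ($0^0=1$). Product network. $\sigma(x)=\max(x,0)$; for $\mathbf u,\mathbf v\in\mathbb R^n$, $\boldsymbol\sigma_{\mathbf v}(\mathbf u)=(\sigma(u_1-v_1),\dots,\sigma(u_n-v_n))^\top$. For scalars $x,y$ let $P_m(x,y)=\mathbf w_{m+3}\boldsymbol\sigma_{\mathbf v_{m+3}}(\mathbf w_{m+2}\boldsymbol\sigma_{\mathbf v_{m+2}}(\cdots\mathbf w_1\boldsymbol\sigma_{\mathbf v_1}(\boldsymbol\ell^m_{x,y})\cdots))$, where $\boldsymbol\ell^m_{x,y}=\frac12(\frac{x-y+1}{2},x-y+1,x+y+2^{-m},\frac{x+y}{2},x+y,\frac12)^\top$; $\mathbf v_k=\mathbf 1_2\otimes(0,2^{1-2k},0)^\top$ for $k\in[m+1]$, $\mathbf v_{m+2}=\mathbf v_{m+3}=-1$; $\mathbf w_k=\mathbf I_2\otimes\widetilde{\mathbf w}$ for $k\in[m]$, $\mathbf w_{m+1}=(-1,1,-1,1,-1,1)$, $\mathbf w_{m+2}=-1$, $\mathbf w_{m+3}=1$; $\widetilde{\mathbf w}=\begin{pmatrix}1/2&-1/2&0\\1&-1&0\\1&-1&1\end{pmatrix}$. $P_m$ is piecewise linear and its derivatives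 are understood piece by piece (slopes of the linear pieces); derivatives of compositions are formed accordingly by the chain rule. Hierarchical network. For $\mathbf u\in\mathbb R^{2^q}$, $q\in\mathbb N$: Step 1 computes $P_m(u_1,u_2),P_m(u_3,u_4),\dots,P_m(u_{2^q-1},u_{2^q})$; Step $n$ ($2\le n\le q$) applies $P_m$ to consecutive pairs of the outputs of Step $n-1$. The single scalar left after $q$ steps is $\mathcal H_m(\mathbf u)$. Input vector. For $\mathbf x\in\mathbb R^r$, $r\ge2$, $\boldsymbol\ell_{\mathbf x\mid\boldsymbol\alpha}=(x_1^{\alpha_1},\dots,x_r^{\alpha_r},\mathbf 1_q^\top)^\top$ with $q=2^{\lceil\log_2r\rceil}-r$, a vector of length $2^{\lceil\log_2r\rceil}$. *)

theory Defs
  imports "HOL-Analysis.Analysis"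
begin

section \<open>The product network\<close>

definition shifted_relu :: "real ^ 'n \<Rightarrow> real ^ 'n \<Rightarrow> real ^ 'n" where
  "shifted_relu v u = (\<chi> i. max (u $ i - v $ i) 0)"

definition net_input :: "nat \<Rightarrow> real \<Rightarrow> real \<Rightarrow> real ^ 6" where
  "net_input m x y = (1 / 2) *\<^sub>R
     vector [(x - y + 1) / 2, x - y + 1, x + y + 1 / 2 ^ m, (x + y) / 2, x + y, 1 / 2]"

definition net_bias :: "nat \<Rightarrow> real ^ 6" where
  "net_bias k = vector [0, 2 powi (1 - 2 * int k), 0, 0, 2 powi (1 - 2 * int k), 0]"

text \<open>The Kronecker product of the 2-by-2 identity with the 3-by-3 block
  in the upper left corner.\<close>

definition net_weight :: "real ^ 6 ^ 6" where
  "net_weight = vector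
    [vector [1/2, -1/2, 0,   0,    0, 0],
     vector [  1,   -1, 0,   0,    0, 0],
     vector [  1,   -1, 1,   0,    0, 0],
     vector [  0,    0, 0, 1/2, -1/2, 0],
     vector [  0,    0, 0,   1,   -1, 0],
     vector [  0,    0, 0,   1,   -1, 1]]"

definition net_weight_out :: "real ^ 6 ^ 1" where
  "net_weight_out = vector [vector [-1, 1, -1, 1, -1, 1]]"

primrec net_hidden :: "nat \<Rightarrow> real ^ 6 \<Rightarrow> real ^ 6" where
  "net_hidden 0 l = l"
| "net_hidden (Suc k) l = net_weight *v shifted_relu (net_bias (Suc k)) (net_hidden k l)"

text \<open>The last two biases are -1, so the last two layers clip the value
  to the interval from 0 to 1.\<close>

definition prod_net :: "nat \<Rightarrow> real \<Rightarrow> real \<Rightarrow> real" where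
  "prod_net m x y =
     ((mat 1 :: real ^ 1 ^ 1) *v shifted_relu (vec (- 1))
       ((mat (- 1) :: real ^ 1 ^ 1) *v shifted_relu (vec (- 1))
         (net_weight_out *v shifted_relu (net_bias (m + 1))
           (net_hidden m (net_input m x y))))) $ 1"


section \<open>Slopes of linear pieces\<close>

text \<open>A linear piece of \<open>f\<close> on \<open>S\<close> is a convex subset of \<open>S\<close> with nonempty interior on which
  \<open>f\<close> is affine; \<open>slopes f S p\<close> consists of the gradients of all pieces that contain \<open>p\<close>.
  At a breakpoint there are several of them, elsewhere in the interior of \<open>S\<close> only the gradient.\<close>

definition slopes :: "('a :: euclidean_space \<Rightarrow> real) \<Rightarrow> 'a set \<Rightarrow> 'a \<Rightarrow> 'a set" where
  "slopes f S p = {g. \<exists>C \<subseteq> S. convex C \<and> interior C \<noteq> {} \<and> p \<in> C \<and>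
                         (\<forall>z\<in>C. f z = f p + g \<bullet> (z - p))}"

text \<open>The pieces are those of the product network as a function on the unit square, which contains
  all arguments that occur in the hierarchical network. Pieces that meet the square only in its
  boundary are not considered: their slopes describe the network outside of its domain of use.\<close>

definition prod_net_slopes :: "nat \<Rightarrow> real \<Rightarrow> real \<Rightarrow> (real \<times> real) set" where
  "prod_net_slopes m x y = slopes (\<lambda>(a, b). prod_net m a b) ({0..1} \<times> {0..1}) (x, y)"


section \<open>The hierarchical network\<close>

text \<open>Vectors of length \<open>n\<close> are functions on the naturals whose values at 1, ..., \<open>n\<close> are the
  entries; the values elsewhere are irrelevant. In \<open>hier_net m q u\<close> the vector \<open>u\<close> has
  length \<open>2 ^ q\<close>, and each step halves the length.\<close>

definition hier_step :: "nat \<Rightarrow> (nat \<Rightarrow> real) \<Rightarrow> nat \<Rightarrow> real" where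
  "hier_step m u k = prod_net m (u (2 * k - 1)) (u (2 * k))"

primrec hier_net :: "nat \<Rightarrow> nat \<Rightarrow> (nat \<Rightarrow> real) \<Rightarrow> real" where
  "hier_net m 0 u = u 1"
| "hier_net m (Suc q) u = hier_net m q (hier_step m u)"

text \<open>Chain rule: \<open>du\<close> is the derivative of \<open>u\<close> with respect to some variable, and
  \<open>hier_net_derivs m q u du\<close> contains the resulting derivatives of \<open>hier_net m q u\<close>,
  for all choices of the linear pieces at the pairs processed in each step.\<close>

definition hier_step_derivs ::
    "nat \<Rightarrow> nat \<Rightarrow> (nat \<Rightarrow> real) \<Rightarrow> (nat \<Rightarrow> real) \<Rightarrow> (nat \<Rightarrow> real) set" where
  "hier_step_derivs m q u du =
     {dw. \<forall>k\<in>{1..2 ^ q}. \<exists>(a, b) \<in> prod_net_slopes m (u (2 * k - 1)) (u (2 * k)).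
            dw k = a * du (2 * k - 1) + b * du (2 * k)}"

primrec hier_net_derivs :: "nat \<Rightarrow> nat \<Rightarrow> (nat \<Rightarrow> real) \<Rightarrow> (nat \<Rightarrow> real) \<Rightarrow> real set" where
  "hier_net_derivs m 0 u du = {du 1}"
| "hier_net_derivs m (Suc q) u du =
     (\<Union>dw \<in> hier_step_derivs m q u du. hier_net_derivs m q (hier_step m u) dw)"


section \<open>Approximation of monomials\<close>

definition ceil_log2 :: "nat \<Rightarrow> nat" where
  "ceil_log2 r = nat \<lceil>log 2 (real r)\<rceil>"

text \<open>Only the entries 1, ..., \<open>2 ^ ceil_log2 r\<close> matter, so this is the vector of powers
  padded with \<open>2 ^ ceil_log2 r - r\<close> ones.\<close>

definition power_input :: "nat \<Rightarrow> (nat \<Rightarrow> nat) \<Rightarrow> (nat \<Rightarrow> real) \<Rightarrow> nat \<Rightarrow> real" where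
  "power_input r \<alpha> x j = (if j \<le> r then x j ^ \<alpha> j else 1)"

definition monomial :: "nat \<Rightarrow> (nat \<Rightarrow> nat) \<Rightarrow> (nat \<Rightarrow> real) \<Rightarrow> real" where
  "monomial r \<alpha> x = (\<Prod>j=1..r. x j ^ \<alpha> j)"

definition monomial_net :: "nat \<Rightarrow> nat \<Rightarrow> (nat \<Rightarrow> nat) \<Rightarrow> (nat \<Rightarrow> real) \<Rightarrow> real" where
  "monomial_net m r \<alpha> x = hier_net m (ceil_log2 r) (power_input r \<alpha> x)"

definition pderiv_at :: "((nat \<Rightarrow> real) \<Rightarrow> real) \<Rightarrow> nat \<Rightarrow> (nat \<Rightarrow> real) \<Rightarrow> real" where
  "pderiv_at f i x = deriv (\<lambda>s. f (x(i := s))) (x i)"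

text \<open>The values at \<open>x\<close> of the partial derivative, with respect to variable \<open>i\<close>, of the difference
  between the network and the monomial.\<close>

definition error_pderivs :: "nat \<Rightarrow> nat \<Rightarrow> (nat \<Rightarrow> nat) \<Rightarrow> nat \<Rightarrow> (nat \<Rightarrow> real) \<Rightarrow> real set" where
  "error_pderivs m r \<alpha> i x =
     {d - pderiv_at (monomial r \<alpha>) i x | d.
        d \<in> hier_net_derivs m (ceil_log2 r) (power_input r \<alpha> x)
               (\<lambda>j. pderiv_at (\<lambda>x. power_input r \<alpha> x j) i x)}"

definition cube :: "nat \<Rightarrow> real \<Rightarrow> (nat \<Rightarrow> real) set" where
  "cube r h = {x. \<forall>i\<in>{1..r}. x i \<in> {0..h}}"


section \<open>Existence of the derivatives\<close>

text \<open>The sets of derivatives above are nonempty on the unit cube, since the product network is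
  affine on each of finitely many closed convex sets that cover the plane.\<close>

definition piecewise_affine :: "'a::euclidean_space set \<Rightarrow> ('a \<Rightarrow> real) \<Rightarrow> bool" where
  "piecewise_affine S f \<longleftrightarrow> (\<exists>F. finite F \<and> S \<subseteq> \<Union>F \<and>
     (\<forall>C\<in>F. closed C \<and> convex C \<and> (\<exists>c a. \<forall>z\<in>C. f z = c + a \<bullet> z)))"

lemma piecewise_affine_affine: "piecewise_affine S (\<lambda>z. c + a \<bullet> z)"
  unfolding piecewise_affine_def by (rule exI[of _ "{UNIV}"]) auto

lemma piecewise_affine_add:
  assumes "piecewise_affine S f" "piecewise_affine S g"
  shows "piecewise_affine S (\<lambda>z. f z + g z)"
proof -
  obtain F where F: "finite F" "S \<subseteq> \<Union>F"
      "\<And>C. C \<in> F \<Longrightarrow> closed C" "\<And>C. C \<in> F \<Longrightarrow> convex C"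
      "\<And>C. C \<in> F \<Longrightarrow> \<exists>c a. \<forall>z\<in>C. f z = c + a \<bullet> z"
    using assms(1) unfolding piecewise_affine_def by meson
  obtain G where G: "finite G" "S \<subseteq> \<Union>G"
      "\<And>C. C \<in> G \<Longrightarrow> closed C" "\<And>C. C \<in> G \<Longrightarrow> convex C"
      "\<And>C. C \<in> G \<Longrightarrow> \<exists>c a. \<forall>z\<in>C. g z = c + a \<bullet> z"
    using assms(2) unfolding piecewise_affine_def by meson
  have "\<exists>c a. \<forall>z\<in>C \<inter> D. f z + g z = c + a \<bullet> z" if CD: "C \<in> F" "D \<in> G" for C D
  proof -
    obtain c a where "\<forall>z\<in>C. f z = c + a \<bullet> z" using F(5)[OF CD(1)] by blast
    moreover obtain c' a' where "\<forall>z\<in>D. g z = c' + a' \<bullet> z" using G(5)[OF CD(2)] by blast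
    ultimately have "\<forall>z\<in>C \<inter> D. f z + g z = (c + c') + (a + a') \<bullet> z"
      by (simp add: inner_add_left)
    then show ?thesis by blast
  qed
  moreover have "S \<subseteq> \<Union>((\<lambda>(C, D). C \<inter> D) ` (F \<times> G))"
  proof
    fix z assume "z \<in> S"
    then obtain C D where "C \<in> F" "z \<in> C" "D \<in> G" "z \<in> D" using F(2) G(2) by blast
    then show "z \<in> \<Union>((\<lambda>(C, D). C \<inter> D) ` (F \<times> G))" by (intro UnionI[of "C \<inter> D"]) auto
  qed
  moreover have "\<forall>E\<in>(\<lambda>(C, D). C \<inter> D) ` (F \<times> G). closed E \<and> convex E"
    using F(3,4) G(3,4) by (auto intro!: convex_Int closed_Int)
  ultimately show ?thesis
    unfolding piecewise_affine_def using F(1) G(1)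
    by (intro exI[of _ "(\<lambda>(C, D). C \<inter> D) ` (F \<times> G)"]) auto
qed

lemma piecewise_affine_mult:
  assumes "piecewise_affine S f"
  shows "piecewise_affine S (\<lambda>z. k * f z)"
proof -
  obtain F where F: "finite F" "S \<subseteq> \<Union>F"
      "\<And>C. C \<in> F \<Longrightarrow> closed C" "\<And>C. C \<in> F \<Longrightarrow> convex C"
      "\<And>C. C \<in> F \<Longrightarrow> \<exists>c a. \<forall>z\<in>C. f z = c + a \<bullet> z"
    using assms(1) unfolding piecewise_affine_def by meson
  have "\<exists>c a. \<forall>z\<in>C. k * f z = c + a \<bullet> z" if CF: "C \<in> F" for C
  proof -
    obtain c a where "\<forall>z\<in>C. f z = c + a \<bullet> z" using F(5)[OF CF] by blast
    then have "\<forall>z\<in>C. k * f z = k * c + (k *\<^sub>R a) \<bullet> z" by (simp add: distrib_left)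
    then show ?thesis by blast
  qed
  then show ?thesis unfolding piecewise_affine_def using F(1-4) by (intro exI[of _ F]) simp
qed

lemma piecewise_affine_sum:
  assumes "\<And>i. i \<in> I \<Longrightarrow> piecewise_affine S (f i)"
  shows "piecewise_affine S (\<lambda>z. \<Sum>i\<in>I. f i z)"
  using assms
proof (induction I rule: infinite_finite_induct)
  case (insert x F)
  then show ?case by (simp add: piecewise_affine_add)
qed (use piecewise_affine_affine[of S 0 0] in simp_all)

lemma piecewise_affine_relu:
  assumes "piecewise_affine S f"
  shows "piecewise_affine S (\<lambda>z. max (f z) 0)"
proof -
  obtain F where F: "finite F" "S \<subseteq> \<Union>F"
      "\<And>C. C \<in> F \<Longrightarrow> closed C" "\<And>C. C \<in> F \<Longrightarrow> convex C"
      "\<And>C. C \<in> F \<Longrightarrow> \<exists>c a. \<forall>z\<in>C. f z = c + a \<bullet> z"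
    using assms(1) unfolding piecewise_affine_def by meson
  then have "\<forall>C\<in>F. \<exists>c a. \<forall>z\<in>C. f z = c + a \<bullet> z" by blast
  then obtain c a where ca: "\<And>C z. C \<in> F \<Longrightarrow> z \<in> C \<Longrightarrow> f z = c C + a C \<bullet> z"
    by metis
  define A where "A C = C \<inter> {z. a C \<bullet> z \<ge> - c C}" for C
  define B where "B C = C \<inter> {z. a C \<bullet> z \<le> - c C}" for C
  have A: "closed (A C) \<and> convex (A C)" "closed (B C) \<and> convex (B C)" if "C \<in> F" for C
    using F(3,4)[OF that] unfolding A_def B_def
    by (auto intro!: convex_Int closed_Int convex_halfspace_ge convex_halfspace_le
          closed_halfspace_ge closed_halfspace_le)
  have "\<forall>z\<in>A C. max (f z) 0 = c C + a C \<bullet> z" "\<forall>z\<in>B C. max (f z) 0 = 0 + 0 \<bullet> z" if "C \<in> F" for C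
    using ca[OF that] unfolding A_def B_def by auto
  then have "\<forall>D\<in>A ` F \<union> B ` F. closed D \<and> convex D \<and> (\<exists>c a. \<forall>z\<in>D. max (f z) 0 = c + a \<bullet> z)"
    using A by blast
  moreover have "S \<subseteq> \<Union>(A ` F \<union> B ` F)"
    using F(2) unfolding A_def B_def by fastforce
  ultimately show ?thesis unfolding piecewise_affine_def using F(1)
    by (intro exI[of _ "A ` F \<union> B ` F"]) auto
qed

lemma slopes_nonempty:
  assumes f: "piecewise_affine S f" and S: "convex S" "closed S" "interior S \<noteq> {}" and p: "p \<in> S"
  shows "slopes f S p \<noteq> {}"
proof -
  obtain F where F: "finite F" "S \<subseteq> \<Union>F"
      "\<And>C. C \<in> F \<Longrightarrow> closed C" "\<And>C. C \<in> F \<Longrightarrow> convex C"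
      "\<And>C. C \<in> F \<Longrightarrow> \<exists>c a. \<forall>z\<in>C. f z = c + a \<bullet> z"
    using f unfolding piecewise_affine_def by meson
  define G where "G = {C \<in> F. interior (C \<inter> S) \<noteq> {}}"
  have fin: "interior (\<Union>C\<in>H. C \<inter> S) = {}" if "finite H" "H \<subseteq> F - G" for H
    using that
  proof (induction H)
    case (insert C H)
    then have "closed (C \<inter> S)" "interior (C \<inter> S) = {}" "interior (\<Union>C\<in>H. C \<inter> S) = {}"
      using F(3) S(2) by (auto simp: G_def)
    then have "interior ((C \<inter> S) \<union> (\<Union>C\<in>H. C \<inter> S)) = {}"
      by (metis interior_closed_Un_empty_interior)
    then show ?case by (simp only: UN_insert)
  qed auto
  have "p \<in> \<Union>G"
  proof (rule ccontr)
    assume np: "p \<notin> \<Union>G"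
    have "closed (\<Union>G)" using F(1,3) unfolding G_def by (intro closed_Union) auto
    then have op: "open (- \<Union>G)" by blast
    have "p \<in> closure (interior S)"
      using p S by (metis convex_closure_interior closure_closed)
    then have "- \<Union>G \<inter> interior S \<noteq> {}"
      using op np by (metis ComplI IntI closure_iff_nhds_not_empty emptyE open_Int_closure_eq_empty)
    moreover have "open (- \<Union>G \<inter> interior S)" using op by auto
    moreover have "- \<Union>G \<inter> interior S \<subseteq> (\<Union>C\<in>F - G. C \<inter> S)"
    proof
      fix z assume z: "z \<in> - \<Union>G \<inter> interior S"
      then have "z \<in> S" using interior_subset by blast
      then obtain C where "C \<in> F" "z \<in> C" using F(2) by blast
      then show "z \<in> (\<Union>C\<in>F - G. C \<inter> S)" using z \<open>z \<in> S\<close> by (intro UN_I[of C]) auto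
    qed
    ultimately have "- \<Union>G \<inter> interior S \<subseteq> interior (\<Union>C\<in>F - G. C \<inter> S)"
      by (intro interior_maximal)
    moreover have "interior (\<Union>C\<in>F - G. C \<inter> S) = {}" using F(1) by (intro fin) auto
    ultimately show False using \<open>- \<Union>G \<inter> interior S \<noteq> {}\<close> by blast
  qed
  then obtain C where C: "C \<in> F" "interior (C \<inter> S) \<noteq> {}" "p \<in> C" unfolding G_def by blast
  obtain c a where ca: "\<forall>z\<in>C. f z = c + a \<bullet> z" using F(5)[OF C(1)] by blast
  have "\<forall>z\<in>C \<inter> S. f z = f p + a \<bullet> (z - p)"
    using ca C(3) by (simp add: inner_diff_right)
  moreover have "convex (C \<inter> S)" using F(4)[OF C(1)] S(1) by (rule convex_Int)
  ultimately have "a \<in> slopes f S p"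
    unfolding slopes_def using C(2,3) p
    by (intro CollectI exI[of _ "C \<inter> S"] conjI Int_lower2 IntI)
  then show ?thesis by blast
qed

lemma piecewise_affine_shifted_relu:
  "(\<And>i. piecewise_affine S (\<lambda>z. u z $ i)) \<Longrightarrow>
    piecewise_affine S (\<lambda>z. shifted_relu v (u z) $ i)"
proof -
  assume "\<And>i. piecewise_affine S (\<lambda>z. u z $ i)"
  then have "piecewise_affine S (\<lambda>z. u z $ i + (- (v $ i) + 0 \<bullet> z))"
    by (intro piecewise_affine_add piecewise_affine_affine)
  from piecewise_affine_relu[OF this] show ?thesis by (simp add: shifted_relu_def)
qed

lemma piecewise_affine_matrix:
  "(\<And>i. piecewise_affine S (\<lambda>z. u z $ i)) \<Longrightarrow>
    piecewise_affine S (\<lambda>z. ((A :: real^'n^'k) *v u z) $ i)"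
  unfolding matrix_vector_mult_def
  by (simp, intro piecewise_affine_sum piecewise_affine_mult)

lemma UNIV_6: "(UNIV :: 6 set) = {1,2,3,4,5,6}"
proof -
  have "x \<in> {1,2,3,4,5,6}" for x :: 6
  proof (induct x)
    case (of_int z)
    then have "z = 0 \<or> z = 1 \<or> z = 2 \<or> z = 3 \<or> z = 4 \<or> z = 5" by auto
    then show ?case by auto
  qed
  then show ?thesis by blast
qed

lemma vector_6: "(vector [a,b,c,d,e,f] :: real^6) $ 1 = a" "(vector [a,b,c,d,e,f] :: real^6) $ 2 = b"
 "(vector [a,b,c,d,e,f] :: real^6) $ 3 = c" "(vector [a,b,c,d,e,f] :: real^6) $ 4 = d"
 "(vector [a,b,c,d,e,f] :: real^6) $ 5 = e" "(vector [a,b,c,d,e,f] :: real^6) $ 6 = f"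
  by (simp_all add: vector_def)

lemma piecewise_affine_input: "piecewise_affine S (\<lambda>z. net_input m (fst z) (snd z) $ i)"
proof -
  have af: "piecewise_affine S g" if "g = (\<lambda>z. c + (a, b) \<bullet> z)" for g :: "real\<times>real \<Rightarrow> real" and a b c
    using that piecewise_affine_affine by simp
  have "i \<in> {1,2,3,4,5,6}" using UNIV_6 by blast
  then show ?thesis
    unfolding net_input_def
    by (elim insertE emptyE; simp only: vector_scaleR_component vector_6)
       (rule af[of _ "1/4" "1/4" "-1/4"] af[of _ "1/2" "1/2" "-1/2"] af[of _ "1/2^m/2" "1/2" "1/2"]
         af[of _ 0 "1/4" "1/4"] af[of _ 0 "1/2" "1/2"] af[of _ "1/4" 0 0];
        auto simp: inner_prod_def field_simps; fail)+
qed

lemma piecewise_affine_hidden: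
  "piecewise_affine S (\<lambda>z. net_hidden k (net_input m (fst z) (snd z)) $ i)"
  by (induction k arbitrary: i)
     (simp_all add: piecewise_affine_input piecewise_affine_matrix piecewise_affine_shifted_relu)

lemma prod_net_slopes_nonempty:
  assumes "x \<in> {0..1}" "y \<in> {0..1}"
  shows "prod_net_slopes m x y \<noteq> {}"
proof -
  have "piecewise_affine S (\<lambda>(a, b). prod_net m a b)" for S
    unfolding prod_net_def case_prod_beta
    by (intro piecewise_affine_matrix piecewise_affine_shifted_relu piecewise_affine_hidden)
  moreover have "({0..1} \<times> {0..1} :: (real \<times> real) set) = cbox (0,0) (1,1)"
    by (auto simp: cbox_Pair_eq)
  moreover have "box (0,0) (1,1 :: real) \<noteq> ({} :: (real\<times>real) set)"
    by (auto simp: box_ne_empty Basis_prod_def)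
  ultimately show ?thesis
    unfolding prod_net_slopes_def using assms
    by (intro slopes_nonempty) (auto simp: interior_cbox)
qed

lemma prod_net_unit: "prod_net m x y \<in> {0..1}"
  by (simp add: prod_net_def matrix_vector_mult_def mat_def shifted_relu_def)

lemma hier_net_derivs_nonempty:
  assumes "\<And>j. j \<in> {1..2 ^ q} \<Longrightarrow> u j \<in> {0..1}"
  shows "hier_net_derivs m q u du \<noteq> {}"
  using assms
proof (induction q arbitrary: u du)
  case (Suc q)
  have "\<exists>g. g \<in> prod_net_slopes m (u (2 * k - 1)) (u (2 * k))" if "k \<in> {1..2 ^ q}" for k
  proof -
    have "2 * k - 1 \<in> {1..2 ^ Suc q}" "2 * k \<in> {1..2 ^ Suc q}" using that by auto
    then have "prod_net_slopes m (u (2 * k - 1)) (u (2 * k)) \<noteq> {}"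
      by (intro prod_net_slopes_nonempty Suc.prems)
    then show ?thesis by blast
  qed
  then obtain g where g: "\<And>k. k \<in> {1..2 ^ q} \<Longrightarrow> g k \<in> prod_net_slopes m (u (2 * k - 1)) (u (2 * k))"
    by metis
  then have "(\<lambda>k. fst (g k) * du (2 * k - 1) + snd (g k) * du (2 * k)) \<in> hier_step_derivs m q u du"
    unfolding hier_step_derivs_def by force
  moreover have "hier_net_derivs m q (hier_step m u) dw \<noteq> {}" for dw
    by (rule Suc.IH) (use prod_net_unit in \<open>auto simp: hier_step_def\<close>)
  ultimately show ?case by auto
qed auto

lemma error_pderivs_nonempty:
  assumes "x \<in> cube r 1"
  shows "error_pderivs m r \<alpha> i x \<noteq> {}"
proof -
  have "power_input r \<alpha> x j \<in> {0..1}" if "j \<ge> 1" for j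
    using assms that by (auto simp: power_input_def cube_def power_le_one)
  then have "hier_net_derivs m q (power_input r \<alpha> x) du \<noteq> {}" for q du
    by (intro hier_net_derivs_nonempty) auto
  then show ?thesis unfolding error_pderivs_def by blast
qed

end

theory Submission
  imports Defs
begin

text \<open>Let \<open>g\<close> be the tent map. Since \<open>t (1 - t) = g(t) / 4 + g(t) (1 - g(t)) / 4\<close>, adding up rescaled iterates of
  \<open>g\<close> approximates \<open>t (1 - t)\<close> with error \<open>e\<^sub>k(t) = G (1 - G) / 4^k\<close>, where \<open>G = g^k(t)\<close>; this error lies
  between 0 and \<open>4^-(k+1)\<close> and is Lipschitz with constant \<open>2^-k\<close>. By polarization, on the unit square
  the product network is \<open>x y + e(s) - e(t) + 2^-(m+1)\<close> with \<open>e = e\<^sub>k\<close>, \<open>k = m + 1\<close>, \<open>s = (x + y) / 2\<close> and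
  \<open>t = (x - y + 1) / 2\<close>, clipped at 1. The Lipschitz bound makes the slopes of the unclipped network
  accurate up to \<open>2^-(m+1)\<close>.

  A step with value error \<open>E\<close> at its inputs has value error at most \<open>2 E + 2^-m\<close>, and of the two factors
  in a product at most one depends on the variable of differentiation. Clipping affects no relevant
  slope: an entry that depends on this variable starts at or below \<open>h\<close> and grows by at most \<open>2^-m\<close>
  per step, so that its products stay below 1; the bound on \<open>h\<close> leaves room for all steps.\<close>

section \<open>Iterated tent map and interpolation error of \<open>t * (1 - t)\<close>\<close>

definition tent :: "real \<Rightarrow> real" where
  "tent t = min (2 * t) (2 - 2 * t)"

text \<open>On the unit interval this is \<open>t * (1 - t)\<close> minus its piecewise linear
  interpolant at the multiples of \<open>1 / 2 ^ k\<close>.\<close>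

definition tent_err :: "nat \<Rightarrow> real \<Rightarrow> real" where
  "tent_err k t = (tent ^^ k) t * (1 - (tent ^^ k) t) / 4 ^ k"

lemma tent_unit: "t \<in> {0..1} \<Longrightarrow> tent t \<in> {0..1}"
  by (auto simp: tent_def)

lemma tent_funpow_unit: "t \<in> {0..1} \<Longrightarrow> (tent ^^ k) t \<in> {0..1}"
  by (induction k) (use tent_unit in auto)

lemma tent_funpow_lipschitz: "\<bar>(tent ^^ k) s - (tent ^^ k) t\<bar> \<le> 2 ^ k * \<bar>s - t\<bar>"
proof (induction k)
  case (Suc k)
  have "\<bar>tent a - tent b\<bar> \<le> 2 * \<bar>a - b\<bar>" for a b by (simp add: tent_def min_def abs_if)
  from this[of "(tent ^^ k) s" "(tent ^^ k) t"] Suc show ?case by simp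
qed simp

lemma tent_err_0: "tent_err 0 t = t * (1 - t)"
  by (simp add: tent_err_def)

text \<open>Telescoping gives \<open>t * (1 - t)\<close> minus the sum of
  \<open>(tent ^^ j) t / 4 ^ j\<close> over \<open>1 \<le> j \<le> k\<close>, which is the sum that
  the hidden layers accumulate.\<close>

lemma tent_err_Suc: "tent_err (Suc k) t = tent_err k t - (tent ^^ Suc k) t / 4 ^ Suc k"
proof -
  have *: "tent u * (1 - tent u) = 4 * (u * (1 - u)) - tent u" for u
    by (auto simp: tent_def min_def field_simps)
  have "tent_err (Suc k) t = (4 * ((tent ^^ k) t * (1 - (tent ^^ k) t)) - (tent ^^ Suc k) t) / 4 ^ Suc k"
    by (simp only: tent_err_def funpow.simps o_apply *)
  then show ?thesis
    by (simp add: tent_err_def diff_divide_distrib)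
qed

lemma tent_err_nonneg: "t \<in> {0..1} \<Longrightarrow> 0 \<le> tent_err k t"
  using tent_funpow_unit[of t k] by (simp add: tent_err_def)

lemma tent_err_le: "tent_err k t \<le> 1 / 4 ^ Suc k"
proof -
  have "u * (1 - u) \<le> 1 / 4" for u :: real
    using zero_le_power2[of "u - 1 / 2"] by (simp add: power2_eq_square algebra_simps)
  from divide_right_mono[OF this[of "(tent ^^ k) t"], of "4 ^ k"] show ?thesis
    by (simp add: tent_err_def)
qed

text \<open>Each level subtracts a nonnegative term. This bound keeps the accumulating entries 3 and
  6 of the hidden layers nonnegative, so that the ReLU leaves them unchanged.\<close>

lemma tent_err_antimono: "t \<in> {0..1} \<Longrightarrow> tent_err k t \<le> t * (1 - t)"
proof (induction k)
  case (Suc k)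
  then show ?case using tent_funpow_unit[of t "Suc k"] tent_err_Suc[of k t]
    by (smt (verit) atLeastAtMost_iff divide_nonneg_nonneg zero_le_power)
qed (simp add: tent_err_0)

lemma tent_err_lipschitz:
  assumes "s \<in> {0..1}" "t \<in> {0..1}"
  shows "\<bar>tent_err k s - tent_err k t\<bar> \<le> \<bar>s - t\<bar> / 2 ^ k"
proof -
  have *: "\<bar>u * (1 - u) - v * (1 - v)\<bar> \<le> \<bar>u - v\<bar>" if "u \<in> {0..1}" "v \<in> {0..1}" for u v :: real
  proof -
    have "u * (1 - u) - v * (1 - v) = (u - v) * (1 - u - v)" by algebra
    moreover have "\<bar>1 - u - v\<bar> \<le> 1" using that by auto
    ultimately show ?thesis by (simp add: abs_mult mult_left_le)
  qed
  let ?u = "(tent ^^ k) s" and ?v = "(tent ^^ k) t"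
  have "\<bar>tent_err k s - tent_err k t\<bar> = \<bar>?u * (1 - ?u) - ?v * (1 - ?v)\<bar> / 4 ^ k"
    by (simp add: tent_err_def flip: diff_divide_distrib)
  also have "\<dots> \<le> (2 ^ k * \<bar>s - t\<bar>) / 4 ^ k"
    using *[OF tent_funpow_unit[OF assms(1)] tent_funpow_unit[OF assms(2)], of k k]
      tent_funpow_lipschitz[of k s t] by (intro divide_right_mono) auto
  also have "\<dots> = \<bar>s - t\<bar> / 2 ^ k"
    by (simp add: field_simps flip: power_mult_distrib)
  finally show ?thesis .
qed

section \<open>Closed form of the product network\<close>

lemma sum_UNIV_6: "(\<Sum>i\<in>(UNIV :: 6 set). f i) = f 1 + f 2 + f 3 + f 4 + f 5 + f 6"
  unfolding UNIV_6 by (simp add: add.assoc)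

lemma forall_6: "(\<forall>i :: 6. P i) \<longleftrightarrow> P 1 \<and> P 2 \<and> P 3 \<and> P 4 \<and> P 5 \<and> P 6"
proof -
  have "(\<forall>i. P i) \<longleftrightarrow> (\<forall>i\<in>UNIV. P i)" by simp
  then show ?thesis unfolding UNIV_6 by simp
qed

lemma net_weight_mult:
  "net_weight *v u = vector [(u $ 1 - u $ 2) / 2, u $ 1 - u $ 2, u $ 1 - u $ 2 + u $ 3,
     (u $ 4 - u $ 5) / 2, u $ 4 - u $ 5, u $ 4 - u $ 5 + u $ 6]"
  unfolding vec_eq_iff forall_6 matrix_vector_mult_def
  by (simp add: net_weight_def vector_def sum_UNIV_6 field_simps)

lemma net_weight_out_mult:
  "(net_weight_out *v u) $ 1 = - u $ 1 + u $ 2 - u $ 3 + u $ 4 - u $ 5 + u $ 6"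
  unfolding matrix_vector_mult_def
  by (simp add: net_weight_out_def vector_def sum_UNIV_6)

text \<open>The hidden state carries iterates scaled by \<open>1 / 4 ^ k\<close>; on that scale the
  bias is the breakpoint 1/2 of the tent map.\<close>

lemma net_bias_Suc: "net_bias (Suc k) = vector [0, 1 / (2 * 4 ^ k), 0, 0, 1 / (2 * 4 ^ k), 0]"
proof -
  have "(2 :: real) powi (1 - 2 * int (Suc k)) = inverse (2 powi (int (2 * k + 1)))"
    by (simp flip: power_int_minus)
  also have "\<dots> = inverse (2 ^ (2 * k + 1))" by (simp only: power_int_of_nat)
  also have "\<dots> = 1 / (2 * 4 ^ k)" by (simp add: power_mult inverse_eq_divide)
  finally have "(2 :: real) powi (1 - 2 * int (Suc k)) = 1 / (2 * 4 ^ k)" .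
  then show ?thesis by (simp only: net_bias_def)
qed

text \<open>The first block iterates the tent map at \<open>t\<close>, the second at
  \<open>s\<close>. Their third entries start at \<open>s + 1 / 2 ^ Suc m\<close> and 1/4,
  respectively, and add up the scaled iterates of the block.\<close>

lemma net_hidden_eq:
  assumes "x \<in> {0..1}" "y \<in> {0..1}"
  defines "s \<equiv> (x + y) / 2" and "t \<equiv> (x - y + 1) / 2"
  shows "net_hidden k (net_input m x y) = vector
    [(tent ^^ k) t / 4 ^ k / 2, (tent ^^ k) t / 4 ^ k, s + 1 / 2 ^ Suc m + t * (1 - t) - tent_err k t,
     (tent ^^ k) s / 4 ^ k / 2, (tent ^^ k) s / 4 ^ k, 1 / 4 + s * (1 - s) - tent_err k s]"
proof (induction k)
  case 0
  show ?case
    unfolding vec_eq_iff forall_6 by (simp add: net_input_def vector_6 s_def t_def tent_err_0 field_simps)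
next
  case (Suc k)
  have st: "s \<in> {0..1}" "t \<in> {0..1}" using assms by auto
  \<comment> \<open>The identity \<open>tent u / 4 = u / 2 - max (u - 1 / 2) 0\<close>, divided by
    \<open>4 ^ k\<close>, makes one layer perform one iteration.\<close>
  have *: "max (u / 4 ^ k / 2) 0 - max (u / 4 ^ k - 1 / (2 * 4 ^ k)) 0 = tent u / 4 ^ Suc k"
    if "u \<in> {0..1}" for u
  proof -
    have a: "max (u / 4 ^ k - 1 / (2 * 4 ^ k)) 0 = max (u - 1 / 2) 0 / 4 ^ k"
      by (simp add: max_def field_simps)
    have b: "max (u / 4 ^ k / 2) 0 = u / 2 / 4 ^ k" using that by (simp add: max.absorb1)
    have c: "u / 2 - max (u - 1 / 2) 0 = tent u / 4" by (auto simp: tent_def max_def min_def)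
    show ?thesis unfolding a b diff_divide_distrib[symmetric] c by simp
  qed
  note tents = *[OF tent_funpow_unit[OF st(1)]] *[OF tent_funpow_unit[OF st(2)]]
  have "0 \<le> s + 1 / 2 ^ Suc m + t * (1 - t) - tent_err k t" "0 \<le> 1 / 4 + s * (1 - s) - tent_err k s"
    using tent_err_antimono[OF st(1), of k] tent_err_antimono[OF st(2), of k] st
      zero_less_power[of "2 :: real" "Suc m"] by (smt (verit) atLeastAtMost_iff divide_nonneg_nonneg)+
  then have max_c: "max (s + 1 / 2 ^ Suc m + t * (1 - t) - tent_err k t) 0 = s + 1 / 2 ^ Suc m + t * (1 - t) - tent_err k t"
     "max (1 / 4 + s * (1 - s) - tent_err k s) 0 = 1 / 4 + s * (1 - s) - tent_err k s"
    by (simp_all only: max.absorb1)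
  show ?case
    unfolding net_hidden.simps Suc.IH net_weight_mult net_bias_Suc shifted_relu_def tent_err_Suc
      vec_lambda_beta vector_6 diff_zero max_c tents funpow.simps o_apply
    by (simp only: algebra_simps)
qed

lemma prod_net_eq:
  assumes "x \<in> {0..1}" "y \<in> {0..1}"
  shows "prod_net m x y = max 0 (min 1 (x * y + tent_err (Suc m) ((x + y) / 2)
    - tent_err (Suc m) ((x - y + 1) / 2) + 1 / 2 ^ Suc m))"
proof -
  define s t where "s = (x + y) / 2" and "t = (x - y + 1) / 2"
  have clip: "((mat 1 :: real ^ 1 ^ 1) *v shifted_relu (vec (- 1))
       ((mat (- 1) :: real ^ 1 ^ 1) *v shifted_relu (vec (- 1)) v)) $ 1 = max 0 (min 1 (- v $ 1))" for v
    by (auto simp: matrix_vector_mult_def mat_def shifted_relu_def max_def min_def)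
  \<comment> \<open>Up to sign, the output weights combine the third and sixth rows of
    \<open>net_weight\<close>. The network thus acts like one more hidden layer, whence the index
    \<open>Suc m\<close> of the error.\<close>
  have h: "net_hidden (Suc m) (net_input m x y) $ 3 = 
     shifted_relu (net_bias (Suc m)) (net_hidden m (net_input m x y)) $ 1
     - shifted_relu (net_bias (Suc m)) (net_hidden m (net_input m x y)) $ 2
     + shifted_relu (net_bias (Suc m)) (net_hidden m (net_input m x y)) $ 3"
     "net_hidden (Suc m) (net_input m x y) $ 6 = 
     shifted_relu (net_bias (Suc m)) (net_hidden m (net_input m x y)) $ 4
     - shifted_relu (net_bias (Suc m)) (net_hidden m (net_input m x y)) $ 5
     + shifted_relu (net_bias (Suc m)) (net_hidden m (net_input m x y)) $ 6"
    by (simp_all add: net_weight_mult vector_6)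
  have "prod_net m x y = max 0 (min 1 (net_hidden (Suc m) (net_input m x y) $ 3
      - net_hidden (Suc m) (net_input m x y) $ 6))"
    unfolding prod_net_def clip net_weight_out_mult h by (simp add: algebra_simps)
  also have "net_hidden (Suc m) (net_input m x y) $ 3 - net_hidden (Suc m) (net_input m x y) $ 6
     = s - s * (1 - s) + t * (1 - t) - 1 / 4 + tent_err (Suc m) s - tent_err (Suc m) t + 1 / 2 ^ Suc m"
    unfolding net_hidden_eq[OF assms, folded s_def t_def] vector_6 by simp
  also have "s - s * (1 - s) + t * (1 - t) - 1 / 4 = x * y"
    by (simp add: s_def t_def field_simps)
  finally show ?thesis by (simp add: s_def t_def)
qed

section \<open>Value and slope errors of the product network\<close>

text \<open>Both errors lie between 0 and \<open>1 / 4 ^ (m + 2)\<close>. The bound is an eighth of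
  the offset \<open>1 / 2 ^ Suc m\<close>.\<close>

lemma tent_err_diff_bound:
  assumes "s \<in> {0..1}" "t \<in> {0..1}"
  shows "\<bar>tent_err (Suc m) s - tent_err (Suc m) t\<bar> \<le> 1 / 16 / 2 ^ m"
proof -
  have "(1 :: real) / 4 ^ Suc (Suc m) \<le> 1 / 16 / 2 ^ m"
    using power_mono[of 2 "4 :: real" m] by (simp add: field_simps)
  then show ?thesis
    using tent_err_le[of "Suc m" s] tent_err_le[of "Suc m" t] assms
      tent_err_nonneg[of s "Suc m"] tent_err_nonneg[of t "Suc m"] by linarith
qed

lemma prod_net_eq_min:
  assumes "x \<in> {0..1}" "y \<in> {0..1}"
  shows "prod_net m x y = min 1 (x * y + tent_err (Suc m) ((x + y) / 2)
    - tent_err (Suc m) ((x - y + 1) / 2) + 1 / 2 ^ Suc m)"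
    (is "_ = min 1 ?N")
proof -
  have "\<bar>tent_err (Suc m) ((x + y) / 2) - tent_err (Suc m) ((x - y + 1) / 2)\<bar> \<le> 1 / 16 / 2 ^ m"
    using assms by (intro tent_err_diff_bound) auto
  moreover have "x * y \<ge> 0" using assms by simp
  moreover have "1 / 16 / 2 ^ m \<le> (1 :: real) / 2 ^ Suc m" by (simp add: field_simps)
  ultimately have "0 \<le> ?N" by linarith
  then show ?thesis unfolding prod_net_eq[OF assms] by simp
qed

text \<open>Without clipping the excess over \<open>x * y\<close> is between 7/16 and 9/16 of
  \<open>1 / 2 ^ m\<close>; clipping at 1 keeps it nonnegative as
  \<open>x * y \<le> 1\<close>.\<close>

lemma prod_net_bounds:
  assumes "x \<in> {0..1}" "y \<in> {0..1}"
  shows "x * y \<le> prod_net m x y" "prod_net m x y \<le> 1" "prod_net m x y \<le> x * y + 1 / 2 ^ m"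
proof -
  have "\<bar>tent_err (Suc m) ((x + y) / 2) - tent_err (Suc m) ((x - y + 1) / 2)\<bar> \<le> 1 / 16 / 2 ^ m"
    using assms by (intro tent_err_diff_bound) auto
  moreover have "x * y \<le> 1" using assms by (simp add: mult_le_one)
  moreover have "1 / 16 / 2 ^ m \<le> (1 :: real) / 2 ^ Suc m"
    "1 / 16 / 2 ^ m + 1 / 2 ^ Suc m \<le> (1 :: real) / 2 ^ m" by (simp_all add: field_simps)
  ultimately show "x * y \<le> prod_net m x y" "prod_net m x y \<le> 1" "prod_net m x y \<le> x * y + 1 / 2 ^ m"
    unfolding prod_net_eq_min[OF assms] by linarith+
qed

text \<open>Slopes are difference quotients inside the piece, where the unclipped formula deviates
  from the product only by a constant and Lipschitz terms.\<close>

lemma prod_net_slopes_bound: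
  assumes ab: "(p, q) \<in> prod_net_slopes m x y" and xy: "x \<in> {0..1}" "y \<in> {0..1}"
    and le: "x * y \<le> 1 - 1 / 2 ^ m"
  shows "\<bar>p - y\<bar> \<le> 1 / 2 ^ Suc m" "\<bar>q - x\<bar> \<le> 1 / 2 ^ Suc m"
proof -
  let ?f = "\<lambda>(a, b). prod_net m a b"
  obtain C where C: "C \<subseteq> {0..1} \<times> {0..1}" "convex C" "interior C \<noteq> {}" "(x, y) \<in> C"
      and f: "\<And>z. z \<in> C \<Longrightarrow> ?f z = ?f (x, y) + (p, q) \<bullet> (z - (x, y))"
    using ab unfolding prod_net_slopes_def slopes_def by blast
  \<comment> \<open>9/16 is the offset 1/2 plus the error bound 1/16: below this threshold the
    clipping at 1 is inactive.\<close>
  define U where "U = {z. fst z * snd z < (1 - 9 / 16 / 2 ^ m :: real)}"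
  have "open U" unfolding U_def by (intro open_Collect_less continuous_intros)
  have "(9 :: real) / 16 / 2 ^ m < 1 / 2 ^ m" by (simp add: field_simps)
  then have "(x, y) \<in> U" using le unfolding U_def by simp
  have unclipped: "prod_net m a b = a * b + tent_err (Suc m) ((a + b) / 2)
      - tent_err (Suc m) ((a - b + 1) / 2) + 1 / 2 ^ Suc m" if "(a, b) \<in> C \<inter> U" for a b
  proof -
    have ab: "a \<in> {0..1}" "b \<in> {0..1}" using that C(1) by auto
    have "a * b < 1 - 9 / 16 / 2 ^ m" using that unfolding U_def by simp
    moreover have "\<bar>tent_err (Suc m) ((a + b) / 2) - tent_err (Suc m) ((a - b + 1) / 2)\<bar> \<le> 1 / 16 / 2 ^ m"
      using ab by (intro tent_err_diff_bound) auto
    moreover have "1 / 16 / 2 ^ m + 1 / 2 ^ Suc m = (9 :: real) / 16 / 2 ^ m" by (simp add: field_simps)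
    ultimately show ?thesis unfolding prod_net_eq_min[OF ab] by linarith
  qed
  \<comment> \<open>Moving one argument by \<open>d\<close> moves both arguments of the errors by
    \<open>\<bar>d\<bar> / 2\<close>, and the two Lipschitz bounds add up.\<close>
  have lip: "\<bar>tent_err (Suc m) s - tent_err (Suc m) s' + tent_err (Suc m) t - tent_err (Suc m) t'\<bar> \<le> \<bar>d\<bar> / 2 ^ Suc m"
    if "s \<in> {0..1}" "s' \<in> {0..1}" "t \<in> {0..1}" "t' \<in> {0..1}" "\<bar>s - s'\<bar> = \<bar>d\<bar> / 2" "\<bar>t - t'\<bar> = \<bar>d\<bar> / 2"
    for s s' t t' d
  proof -
    have "\<bar>d\<bar> / 2 / 2 ^ Suc m + \<bar>d\<bar> / 2 / 2 ^ Suc m = \<bar>d\<bar> / 2 ^ Suc m" by simp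
    then show ?thesis
      using tent_err_lipschitz[OF that(1,2), of "Suc m"] tent_err_lipschitz[OF that(3,4), of "Suc m"]
      unfolding that(5,6) by linarith
  qed
  have *: "\<bar>p - b\<bar> \<le> 1 / 2 ^ Suc m \<and> \<bar>q - a\<bar> \<le> 1 / 2 ^ Suc m" if ab: "(a, b) \<in> interior C \<inter> U" for a b
  proof -
    have "open (interior C \<inter> U)" using \<open>open U\<close> by auto
    then obtain e where e: "e > 0" "ball (a, b) e \<subseteq> interior C \<inter> U" using ab by (meson openE)
    define d where "d = e / 2"
    have d: "d > 0" using e by (simp add: d_def)
    have "(a + d, b) \<in> interior C \<inter> U" "(a, b + d) \<in> interior C \<inter> U"
      using e by (auto simp: d_def dist_Pair_Pair dist_norm intro!: subsetD[OF e(2)])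
    then have in_CU: "(a + d, b) \<in> C \<inter> U" "(a, b + d) \<in> C \<inter> U" "(a, b) \<in> C \<inter> U"
      using ab interior_subset by blast+
    have u: "a \<in> {0..1}" "b \<in> {0..1}" "a + d \<in> {0..1}" "b + d \<in> {0..1}" using in_CU C(1) by auto
    have "p * d = prod_net m (a + d) b - prod_net m a b"
      using f[of "(a + d, b)"] f[of "(a, b)"] in_CU by (simp add: algebra_simps)
    also have "\<dots> = b * d + (tent_err (Suc m) ((a + d + b) / 2) - tent_err (Suc m) ((a + b) / 2)
        + tent_err (Suc m) ((a - b + 1) / 2) - tent_err (Suc m) ((a + d - b + 1) / 2))"
      unfolding unclipped[OF in_CU(1)] unclipped[OF in_CU(3)] by (simp add: algebra_simps)
    finally have "(p - b) * d = tent_err (Suc m) ((a + d + b) / 2) - tent_err (Suc m) ((a + b) / 2)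
        + tent_err (Suc m) ((a - b + 1) / 2) - tent_err (Suc m) ((a + d - b + 1) / 2)"
      by (simp add: left_diff_distrib)
    also have "\<bar>\<dots>\<bar> \<le> \<bar>d\<bar> / 2 ^ Suc m"
      using u d by (intro lip) (auto simp: abs_if field_simps)
    finally have "\<bar>(p - b) * d\<bar> \<le> \<bar>d\<bar> / 2 ^ Suc m" .
    then have "\<bar>p - b\<bar> * d \<le> 1 / 2 ^ Suc m * d" using d by (simp add: abs_mult)
    then have 1: "\<bar>p - b\<bar> \<le> 1 / 2 ^ Suc m" using d by (rule mult_right_le_imp_le)
    have "q * d = prod_net m a (b + d) - prod_net m a b"
      using f[of "(a, b + d)"] f[of "(a, b)"] in_CU by (simp add: algebra_simps)
    also have "\<dots> = a * d + (tent_err (Suc m) ((a + (b + d)) / 2) - tent_err (Suc m) ((a + b) / 2)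
        + tent_err (Suc m) ((a - b + 1) / 2) - tent_err (Suc m) ((a - (b + d) + 1) / 2))"
      unfolding unclipped[OF in_CU(2)] unclipped[OF in_CU(3)] by (simp add: algebra_simps)
    finally have "(q - a) * d = tent_err (Suc m) ((a + (b + d)) / 2) - tent_err (Suc m) ((a + b) / 2)
        + tent_err (Suc m) ((a - b + 1) / 2) - tent_err (Suc m) ((a - (b + d) + 1) / 2)"
      by (simp add: left_diff_distrib)
    also have "\<bar>\<dots>\<bar> \<le> \<bar>d\<bar> / 2 ^ Suc m"
      using u d by (intro lip) (auto simp: abs_if field_simps)
    finally have "\<bar>(q - a) * d\<bar> \<le> \<bar>d\<bar> / 2 ^ Suc m" .
    then have "\<bar>q - a\<bar> * d \<le> 1 / 2 ^ Suc m * d" using d by (simp add: abs_mult)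
    then have 2: "\<bar>q - a\<bar> \<le> 1 / 2 ^ Suc m" using d by (rule mult_right_le_imp_le)
    from 1 2 show ?thesis ..
  qed
  \<comment> \<open>The point may lie on the boundary of \<open>C\<close>. A convex set with
    nonempty interior lies in the closure of its interior, so the bounds pass to the limit.\<close>
  have cl: "(x, y) \<in> closure (interior C)"
    using C(2-4) closure_subset by (auto simp: convex_closure_interior)
  have "\<bar>p - y\<bar> \<le> 1 / 2 ^ Suc m + \<epsilon> \<and> \<bar>q - x\<bar> \<le> 1 / 2 ^ Suc m + \<epsilon>" if "\<epsilon> > 0" for \<epsilon>
  proof -
    have "open (U \<inter> ball (x, y) \<epsilon>)" "(x, y) \<in> U \<inter> ball (x, y) \<epsilon>"
      using \<open>open U\<close> \<open>(x, y) \<in> U\<close> that by auto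
    then have "interior C \<inter> (U \<inter> ball (x, y) \<epsilon>) \<noteq> {}"
      using cl by (meson closure_iff_nhds_not_empty subset_refl)
    then obtain a b where ab: "(a, b) \<in> interior C \<inter> U" "dist (x, y) (a, b) < \<epsilon>"
      by (metis IntE IntI equals0I mem_ball surj_pair)
    have "\<bar>x - a\<bar> < \<epsilon>" "\<bar>y - b\<bar> < \<epsilon>"
      using dist_fst_le[of "(x, y)" "(a, b)"] dist_snd_le[of "(x, y)" "(a, b)"] ab(2)
      by (simp_all add: dist_real_def)
    then show ?thesis using *[OF ab(1)] by linarith
  qed
  then show "\<bar>p - y\<bar> \<le> 1 / 2 ^ Suc m" "\<bar>q - x\<bar> \<le> 1 / 2 ^ Suc m"
    by (meson field_le_epsilon)+
qed

section \<open>Error propagation through the hierarchy\<close>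

lemma prod_pairs: "(\<Prod>j=1..2 * n. f j) = (\<Prod>k=1..n. f (2 * k - 1) * f (2 * k :: nat))"
  by (induction n) (auto simp: mult_ac)

text \<open>Exact values \<open>U\<close> accompany the computed ones \<open>u\<close>, so that
  errors of the first step become input errors of the remaining ones. The bound solves the recursion
  from \<open>E\<close> to \<open>2 * E + 1 / 2 ^ m\<close>.\<close>

lemma hier_net_bounds:
  assumes "\<And>j. j \<in> {1..2 ^ q} \<Longrightarrow> 0 \<le> U j \<and> U j \<le> u j \<and> u j \<le> 1 \<and> u j - U j \<le> E"
  shows "(\<Prod>j=1..2 ^ q. U j) \<le> hier_net m q u \<and> hier_net m q u \<le> 1
    \<and> hier_net m q u - (\<Prod>j=1..2 ^ q. U j) \<le> 2 ^ q * E + (2 ^ q - 1) * (1 / 2 ^ m)"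
  using assms
proof (induction q arbitrary: u U E)
  case (Suc q)
  let ?V = "\<lambda>k. U (2 * k - 1) * U (2 * k)"
  have "0 \<le> ?V k \<and> ?V k \<le> hier_step m u k \<and> hier_step m u k \<le> 1
    \<and> hier_step m u k - ?V k \<le> 2 * E + 1 / 2 ^ m" if "k \<in> {1..2 ^ q}" for k
  proof -
    have "2 * k - 1 \<in> {1..2 ^ Suc q}" "2 * k \<in> {1..2 ^ Suc q}" using that by auto
    from this[THEN Suc.prems] obtain a b A B where
      eqs: "a = u (2 * k - 1)" "b = u (2 * k)" "A = U (2 * k - 1)" "B = U (2 * k)" and
      *: "0 \<le> A" "A \<le> a" "a \<le> 1" "a - A \<le> E" "0 \<le> B" "B \<le> b" "b \<le> 1" "b - B \<le> E" by blast
    have "A * B \<le> a * b" using * by (intro mult_mono) auto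
    moreover have "a * b - A * B = (a - A) * b + A * (b - B)" by algebra
    moreover have "(a - A) * b \<le> E * 1" "A * (b - B) \<le> 1 * E" using * by (intro mult_mono; linarith)+
    ultimately show ?thesis
      using prod_net_bounds[of a b m] * unfolding hier_step_def eqs[symmetric] by auto
  qed
  from Suc.IH[of ?V "hier_step m u" "2 * E + 1 / 2 ^ m", OF this]
  moreover have "2 ^ q * (2 * E + 1 / 2 ^ m) + (2 ^ q - 1) * (1 / 2 ^ m)
      = 2 * 2 ^ q * E + (2 * 2 ^ q - 1) * (1 / 2 ^ m)" by (simp add: algebra_simps diff_divide_distrib)
  ultimately show ?case unfolding hier_net.simps power_Suc prod_pairs by simp
qed simp

text \<open>The value error after \<open>n\<close> steps is \<open>(2^n - 1) \<delta>\<close>. The derivative error \<open>(3^n - 1) / 3\<close>, unlike \<open>3^(n-1)\<close>,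
  vanishes at \<open>n = 0\<close>, so that the induction can start at the exact input.\<close>

lemma deriv_err_step:
  fixes a' A' b B p c \<delta> :: real
  assumes "\<bar>p - b\<bar> \<le> \<delta> / 2" "0 \<le> B" "B \<le> b" "b \<le> 1" "b - B \<le> (2 ^ n - 1) * \<delta>"
    and "\<bar>a' - A'\<bar> \<le> (3 ^ n - 1) / 3 * \<delta> * c" "\<bar>A'\<bar> \<le> c" "\<delta> \<le> 1 / 2" "0 \<le> \<delta>"
  shows "\<bar>p * a' - B * A'\<bar> \<le> (3 ^ Suc n - 1) / 3 * \<delta> * c"
proof -
  have c: "0 \<le> c" using assms(7) by linarith
  \<comment> \<open>Equivalent to the final comparison of
    \<open>5 / 12 * 3 ^ n + 2 ^ n - 11 / 12\<close> with \<open>3 ^ n - 1 / 3\<close>.\<close>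
  have n: "(2 :: real) ^ n \<le> 7 / 12 * (3 ^ n + 1)"
  proof (induction n)
    case (Suc n)
    have *: "2 * Y \<le> 7 / 12 * (3 * X + 1)" if "1 \<le> X" "Y \<le> 7 / 12 * (X + 1)" for X Y :: real
      using that by simp
    show ?case unfolding power_Suc using Suc by (intro *) auto
  qed simp
  \<comment> \<open>5/4 is \<open>1 + \<delta> / 2\<close> at the largest value
    \<open>\<delta> = 1 / 2\<close>.\<close>
  have p: "\<bar>p\<bar> \<le> 5 / 4" "\<bar>p - B\<bar> \<le> (2 ^ n - 1) * \<delta> + \<delta> / 2" using assms(1-5,8,9) by linarith+
  have "p * a' - B * A' = p * (a' - A') + (p - B) * A'" by algebra
  then have "\<bar>p * a' - B * A'\<bar> \<le> \<bar>p\<bar> * \<bar>a' - A'\<bar> + \<bar>p - B\<bar> * \<bar>A'\<bar>"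
    by (metis abs_mult abs_triangle_ineq)
  also have "\<dots> \<le> 5 / 4 * ((3 ^ n - 1) / 3 * \<delta> * c) + ((2 ^ n - 1) * \<delta> + \<delta> / 2) * c"
    using p assms(6,7,9) by (intro add_mono mult_mono) (auto intro!: mult_nonneg_nonneg add_nonneg_nonneg c)
  also have "\<dots> = (5 / 12 * 3 ^ n + 2 ^ n - 11 / 12) * (\<delta> * c)" by (simp add: field_simps)
  also have "\<dots> \<le> ((3 ^ Suc n - 1) / 3) * (\<delta> * c)"
    using n c assms(9) by (intro mult_right_mono) (auto simp: field_simps)
  finally show ?thesis by (simp add: mult.assoc)
qed

text \<open>Here \<open>n\<close> steps are done and \<open>q\<close> remain. Only entry
  \<open>i\<close> has a nonzero derivative; its bound \<open>c\<close> persists because the other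
  factors are at most 1. \<open>small\<close> reserves a margin \<open>\<delta>\<close> for each
  remaining step, or allows a zero derivative, as for the constant 1 that a zero exponent
  yields.\<close>

lemma hier_net_derivs_bound:
  fixes U :: "nat \<Rightarrow> real \<Rightarrow> real" and m :: nat
  defines "\<delta> \<equiv> 1 / 2 ^ m"
  assumes m: "m \<ge> 1"
    and u: "\<And>j. j \<in> {1..2 ^ q} \<Longrightarrow> 0 \<le> U j s \<and> U j s \<le> u j \<and> u j \<le> 1 \<and> u j - U j s \<le> (2 ^ n - 1) * \<delta>"
    and U: "\<And>j. j \<in> {1..2 ^ q} \<Longrightarrow> (U j has_real_derivative dU j) (at s)"
    and i: "i \<in> {1..2 ^ q}" "\<And>j. j \<noteq> i \<Longrightarrow> j \<in> {1..2 ^ q} \<Longrightarrow> du j = 0 \<and> dU j = 0"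
    and small: "u i \<le> 1 - real q * \<delta> \<or> du i = 0 \<and> dU i = 0"
    and du: "\<bar>du i - dU i\<bar> \<le> (3 ^ n - 1) / 3 * \<delta> * c" "\<bar>dU i\<bar> \<le> c"
    and d: "d \<in> hier_net_derivs m q u du"
  shows "\<exists>D. ((\<lambda>s. \<Prod>j=1..2 ^ q. U j s) has_real_derivative D) (at s)
    \<and> \<bar>d - D\<bar> \<le> (3 ^ (n + q) - 1) / 3 * \<delta> * c"
  using u U i small du d
proof (induction q arbitrary: u U du dU i n)
  case 0
  then show ?case by (intro exI[of _ "dU 1"]) auto
next
  case (Suc q)
  note prems = Suc.prems
  obtain dw where dw: "dw \<in> hier_step_derivs m q u du" "d \<in> hier_net_derivs m q (hier_step m u) dw"
    using prems(8) by auto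
  have \<delta>: "0 < \<delta>" "\<delta> \<le> 1 / 2" "\<delta> / 2 = 1 / 2 ^ Suc m"
    using m self_le_power[of "2 :: real" m] by (auto simp: \<delta>_def field_simps)
  let ?V = "\<lambda>k s. U (2 * k - 1) s * U (2 * k) s"
  let ?dV = "\<lambda>k. dU (2 * k - 1) * U (2 * k) s + dU (2 * k) * U (2 * k - 1) s"
  define i' where "i' = (i + 1) div 2"
  have i': "i' \<in> {1..2 ^ q}" "i = 2 * i' - 1 \<or> i = 2 * i'" using prems(3) unfolding i'_def by auto
  have idx: "2 * k - 1 \<in> {1..2 ^ Suc q}" "2 * k \<in> {1..2 ^ Suc q}" if "k \<in> {1..2 ^ q}" for k :: nat
    using that by auto
  have step: "\<exists>(p, p') \<in> prod_net_slopes m (u (2 * k - 1)) (u (2 * k)).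
            dw k = p * du (2 * k - 1) + p' * du (2 * k)" if "k \<in> {1..2 ^ q}" for k
    using dw(1) that unfolding hier_step_derivs_def by blast
  have 1: "0 \<le> ?V k s \<and> ?V k s \<le> hier_step m u k \<and> hier_step m u k \<le> 1
      \<and> hier_step m u k - ?V k s \<le> (2 ^ Suc n - 1) * \<delta>" if "k \<in> {1..2 ^ q}" for k
  proof -
    have "0 \<le> U (2 * k - 1) s" "0 \<le> U (2 * k) s" using prems(1) idx[OF that] by blast+
    \<comment> \<open>The step at pair \<open>k\<close> is a network of depth 1 on the shifted
      entries, with error \<open>2 * ((2 ^ n - 1) * \<delta>) + \<delta> = (2 ^ Suc n - 1) *
      \<delta>\<close>.\<close>
    moreover have "(\<Prod>j=1..2 ^ 1. U (2 * (k - 1) + j) s) \<le> hier_net m 1 (\<lambda>j. u (2 * (k - 1) + j))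
       \<and> hier_net m 1 (\<lambda>j. u (2 * (k - 1) + j)) \<le> 1
      \<and> hier_net m 1 (\<lambda>j. u (2 * (k - 1) + j)) - (\<Prod>j=1..2 ^ 1. U (2 * (k - 1) + j) s)
          \<le> 2 ^ 1 * ((2 ^ n - 1) * \<delta>) + (2 ^ 1 - 1) * (1 / 2 ^ m)"
      using that by (intro hier_net_bounds prems(1)) auto
    moreover have "Suc (2 * (k - 1)) = 2 * k - 1" "Suc (2 * k - 1) = 2 * k" using that by auto
    ultimately show ?thesis
      using that by (simp add: hier_step_def numeral_2_eq_2 \<delta>_def[symmetric] algebra_simps)
  qed
  have 2: "(?V k has_real_derivative ?dV k) (at s)" if "k \<in> {1..2 ^ q}" for k
    using idx[OF that] by (intro DERIV_mult prems(2)) auto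
  have 3: "dw k = 0 \<and> ?dV k = 0" if "k \<noteq> i'" "k \<in> {1..2 ^ q}" for k
  proof -
    have "2 * k - 1 \<noteq> i" "2 * k \<noteq> i" using that i'(2) i'(1) by auto
    then have "du (2 * k - 1) = 0 \<and> dU (2 * k - 1) = 0" "du (2 * k) = 0 \<and> dU (2 * k) = 0"
      using prems(4) idx[OF that(2)] by blast+
    then show ?thesis using step[OF that(2)] by auto
  qed
  \<comment> \<open>\<open>j\<close> is the sibling of \<open>i\<close>, and \<open>p\<close> is the slope in the argument \<open>i\<close>.\<close>
  obtain j p where j: "j \<in> {1..2 ^ Suc q}" "j \<noteq> i"
    and dw_i: "dw i' = p * du i" and dV_i: "?dV i' = dU i * U j s" and V_i: "?V i' s = U i s * U j s"
    and h_i: "hier_step m u i' \<le> u i * u j + \<delta>"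
    and p: "u i * u j \<le> 1 - \<delta> \<Longrightarrow> \<bar>p - u j\<bar> \<le> \<delta> / 2"
  proof -
    obtain p p' where pp: "(p, p') \<in> prod_net_slopes m (u (2 * i' - 1)) (u (2 * i'))"
       "dw i' = p * du (2 * i' - 1) + p' * du (2 * i')" using step[OF i'(1)] by blast
    have uu: "u (2 * i' - 1) \<in> {0..1}" "u (2 * i') \<in> {0..1}"
      using prems(1) idx[OF i'(1)] by (meson atLeastAtMost_iff order_trans)+
    note h = prod_net_bounds(3)[OF uu, of m, folded \<delta>_def]
    note s = prod_net_slopes_bound[OF pp(1) uu, folded \<delta>_def \<delta>(3)]
    have ne: "2 * i' - 1 \<noteq> 2 * i'" using i'(1) by auto
    from i'(2) show thesis
    proof
      assume i: "i = 2 * i' - 1"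
      then have "du (2 * i') = 0 \<and> dU (2 * i') = 0" using prems(4) idx[OF i'(1)] ne by metis
      then show thesis using that[of "2 * i'" p] idx[OF i'(1)] i pp h s ne by (auto simp: hier_step_def)
    next
      assume i: "i = 2 * i'"
      then have "du (2 * i' - 1) = 0 \<and> dU (2 * i' - 1) = 0" using prems(4) idx[OF i'(1)] ne by metis
      then show thesis using that[of "2 * i' - 1" p'] idx[OF i'(1)] i pp h s ne
        by (auto simp: hier_step_def mult.commute)
    qed
  qed
  have ui: "0 \<le> u i" "u i \<le> 1" and uj: "0 \<le> U j s" "U j s \<le> u j" "u j \<le> 1" "u j - U j s \<le> (2 ^ n - 1) * \<delta>"
    using prems(1)[OF j(1)] prems(1)[OF prems(3)] by auto
  have le: "u i * u j \<le> u i" using ui uj by (simp add: mult_left_le)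
  have 4: "hier_step m u i' \<le> 1 - real q * \<delta> \<or> dw i' = 0 \<and> ?dV i' = 0"
    using prems(5)
  proof
    assume "u i \<le> 1 - real (Suc q) * \<delta>"
    then show ?thesis using le h_i by (auto simp: algebra_simps)
  next
    assume "du i = 0 \<and> dU i = 0"
    then show ?thesis unfolding dw_i dV_i by simp
  qed
  have 5: "\<bar>dw i' - ?dV i'\<bar> \<le> (3 ^ Suc n - 1) / 3 * \<delta> * c"
    using prems(5)
  proof
    assume "u i \<le> 1 - real (Suc q) * \<delta>"
    moreover have "0 \<le> real q * \<delta>" using \<delta> by simp
    \<comment> \<open>The margin \<open>\<delta>\<close> reserved for this step is exactly what the
      slope bound requires.\<close>
    ultimately have "u i * u j \<le> 1 - \<delta>" using le by (simp add: algebra_simps)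
    then have "\<bar>p * du i - U j s * dU i\<bar> \<le> (3 ^ Suc n - 1) / 3 * \<delta> * c"
      using p uj prems(6,7) \<delta> by (intro deriv_err_step[of p "u j"]) auto
    then show ?thesis unfolding dw_i dV_i mult.commute[of "dU i"] .
  next
    have "0 \<le> c" using prems(7) by linarith
    moreover have "(1 :: real) \<le> 3 ^ Suc n" by (rule one_le_power) simp
    moreover assume "du i = 0 \<and> dU i = 0"
    ultimately show ?thesis using \<delta> unfolding dw_i dV_i by simp
  qed
  have 6: "\<bar>?dV i'\<bar> \<le> c"
  proof -
    have "\<bar>dU i\<bar> * U j s \<le> c * 1" using prems(7) uj by (intro mult_mono) auto
    then show ?thesis unfolding dV_i using uj by (simp add: abs_mult)
  qed
  from Suc.IH[of ?V "hier_step m u" "Suc n" ?dV i' dw, OF 1 2 i'(1) 3 4 5 6 dw(2)]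
  show ?case unfolding power_Suc prod_pairs by simp
qed

section \<open>Application to monomials\<close>

lemma le_two_power_ceil_log2: "r \<ge> 1 \<Longrightarrow> r \<le> 2 ^ ceil_log2 r"
proof -
  assume r: "r \<ge> 1"
  have "real r = 2 powr log 2 (real r)" using r by simp
  also have "\<dots> \<le> 2 powr real (ceil_log2 r)"
    using real_nat_ceiling_ge[of "log 2 (real r)"] unfolding ceil_log2_def by (intro powr_mono) auto
  also have "\<dots> = real (2 ^ ceil_log2 r)" by (simp add: powr_realpow)
  finally show ?thesis by (simp only: of_nat_le_iff)
qed

lemma ceil_log2_pos: "r \<ge> 2 \<Longrightarrow> ceil_log2 r \<ge> 1"
  using le_two_power_ceil_log2[of r] by (cases "ceil_log2 r") auto

lemma prod_power_input:
  assumes "r \<ge> 1"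
  shows "(\<Prod>j=1..2 ^ ceil_log2 r. power_input r \<alpha> x j) = monomial r \<alpha> x"
proof -
  have "(\<Prod>j=1..r. power_input r \<alpha> x j) = (\<Prod>j=1..2 ^ ceil_log2 r. power_input r \<alpha> x j)"
    using le_two_power_ceil_log2[OF assms]
    by (intro prod.mono_neutral_left) (auto simp: power_input_def)
  then show ?thesis by (simp add: monomial_def power_input_def)
qed

lemma power_input_unit:
  assumes "x \<in> cube r h" "h \<le> 1" "j \<ge> 1"
  shows "0 \<le> power_input r \<alpha> x j" "power_input r \<alpha> x j \<le> 1"
proof -
  have "x j \<in> {0..h}" if "j \<le> r" using assms(1,3) that unfolding cube_def by simp
  then show "0 \<le> power_input r \<alpha> x j" "power_input r \<alpha> x j \<le> 1"
    using assms(2) by (auto simp: power_input_def intro!: power_le_one)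
qed

text \<open>Turns the factor \<open>2 ^ L - 1\<close> from \<open>hier_net_bounds\<close> into
  \<open>3 ^ (L - 1)\<close>, with \<open>n = L - 1\<close>.\<close>

lemma two_power_le_three_power: "(2 :: real) ^ Suc n - 1 \<le> 3 ^ n"
proof (induction n)
  case (Suc n)
  have "(2 :: real) ^ Suc (Suc n) - 1 \<le> 2 * 3 ^ n + 1" using Suc by simp
  also have "\<dots> \<le> 3 * 3 ^ n" using one_le_power[of "3 :: real" n] by linarith
  finally show ?case by simp
qed simp

lemma monomial_net_bounds:
  assumes "r \<ge> 2" "h \<le> 1" "x \<in> cube r h"
  shows "0 \<le> monomial r \<alpha> x" "monomial r \<alpha> x \<le> monomial_net m r \<alpha> x" "monomial_net m r \<alpha> x \<le> 1"
    "monomial_net m r \<alpha> x - monomial r \<alpha> x \<le> 3 ^ (ceil_log2 r - 1) * (1 / 2 ^ m)"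
proof -
  let ?u = "power_input r \<alpha> x" and ?L = "ceil_log2 r"
  \<comment> \<open>The inputs are exact: \<open>?u\<close> serves as its own reference, with
    \<open>E = 0\<close>.\<close>
  have u: "0 \<le> ?u j \<and> ?u j \<le> ?u j \<and> ?u j \<le> 1 \<and> ?u j - ?u j \<le> 0" if "j \<in> {1..2 ^ ?L}" for j
    using power_input_unit[OF assms(3,2), of j] that by simp
  have r: "r \<ge> 1" using assms(1) by simp
  note * = hier_net_bounds[of ?L ?u ?u 0 m, OF u, unfolded prod_power_input[OF r], folded monomial_net_def]
  have L: "Suc (?L - 1) = ?L" using ceil_log2_pos[OF assms(1)] by simp
  have "((2 :: real) ^ ?L - 1) * (1 / 2 ^ m) \<le> 3 ^ (?L - 1) * (1 / 2 ^ m)"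
    using two_power_le_three_power[of "?L - 1", unfolded L] by (intro mult_right_mono) auto
  then show "monomial_net m r \<alpha> x - monomial r \<alpha> x \<le> 3 ^ (?L - 1) * (1 / 2 ^ m)" using * by linarith
  show "0 \<le> monomial r \<alpha> x"
    unfolding prod_power_input[OF r, symmetric] using u by (intro prod_nonneg) auto
  show "monomial r \<alpha> x \<le> monomial_net m r \<alpha> x" "monomial_net m r \<alpha> x \<le> 1" using * by auto
qed

lemma error_pderivs_bound:
  assumes "m \<ge> 1" "r \<ge> 2" and h: "h \<le> 1 - real (ceil_log2 r) * (1 / 2 ^ m)"
    and x: "x \<in> cube r h" and i: "i \<in> {1..r}" and d: "d \<in> error_pderivs m r \<alpha> i x"
  shows "\<bar>d\<bar> \<le> 3 ^ (ceil_log2 r - 1) * real (\<Sum>j=1..r. \<alpha> j) * (1 / 2 ^ m)"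
proof -
  let ?L = "ceil_log2 r"
  let ?U = "\<lambda>j s. power_input r \<alpha> (x(i := s)) j"
  define dU where "dU j = (if j = i then real (\<alpha> i) * x i ^ (\<alpha> i - 1) else 0)" for j
  have "0 \<le> real ?L * (1 / 2 ^ m)" by simp
  then have "h \<le> 1" using h by linarith
  have xi: "x i \<in> {0..h}" using x i unfolding cube_def by blast
  have U: "(?U j has_real_derivative dU j) (at (x i))" for j
  proof (cases "j = i")
    case True
    then have "?U j = (\<lambda>s. s ^ \<alpha> i)" using i by (auto simp: power_input_def)
    then show ?thesis using DERIV_pow[of "\<alpha> i" "x i"] True by (simp add: dU_def)
  next
    case False
    then have "?U j = (\<lambda>s. power_input r \<alpha> x j)" by (auto simp: power_input_def)
    then show ?thesis using False by (simp add: dU_def)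
  qed
  have du: "pderiv_at (\<lambda>x. power_input r \<alpha> x j) i x = dU j" for j
    unfolding pderiv_at_def using DERIV_imp_deriv[OF U] .
  obtain d' where d': "d = d' - pderiv_at (monomial r \<alpha>) i x"
      "d' \<in> hier_net_derivs m ?L (power_input r \<alpha> x) dU"
    using d unfolding error_pderivs_def du by blast
  \<comment> \<open>Instance \<open>n = 0\<close> and \<open>c = real (\<alpha> i)\<close>: values
    and derivatives are exact at the start.\<close>
  have "\<exists>D. ((\<lambda>s. \<Prod>j=1..2 ^ ?L. ?U j s) has_real_derivative D) (at (x i))
    \<and> \<bar>d' - D\<bar> \<le> (3 ^ (0 + ?L) - 1) / 3 * (1 / 2 ^ m) * real (\<alpha> i)"
  proof (rule hier_net_derivs_bound[where U = ?U and dU = dU and i = i, OF \<open>m \<ge> 1\<close> _ U _ _ _ _ _ d'(2)])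
    show "0 \<le> ?U j (x i) \<and> ?U j (x i) \<le> power_input r \<alpha> x j \<and> power_input r \<alpha> x j \<le> 1 \<and>
        power_input r \<alpha> x j - ?U j (x i) \<le> (2 ^ 0 - 1) * (1 / 2 ^ m)" if "j \<in> {1..2 ^ ?L}" for j
      using power_input_unit[OF x \<open>h \<le> 1\<close>, of j] that by simp
    show "i \<in> {1..2 ^ ?L}" using i le_two_power_ceil_log2[of r] by auto
    show "dU j = 0 \<and> dU j = 0" if "j \<noteq> i" for j using that by (simp add: dU_def)
    \<comment> \<open>A positive power of \<open>x i\<close> is at most \<open>x i\<close>, hence at
      most \<open>h\<close>; a zero exponent falls under the second alternative.\<close>
    show "power_input r \<alpha> x i \<le> 1 - real ?L * (1 / 2 ^ m) \<or> dU i = 0 \<and> dU i = 0"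
    proof (cases "\<alpha> i")
      case (Suc k)
      have "x i * x i ^ k \<le> x i" using xi \<open>h \<le> 1\<close> by (intro mult_left_le power_le_one) auto
      then show ?thesis using Suc xi h i by (simp add: power_input_def)
    qed (simp add: dU_def)
    show "\<bar>dU i - dU i\<bar> \<le> (3 ^ 0 - 1) / 3 * (1 / 2 ^ m) * real (\<alpha> i)" by simp
    have "\<bar>x i ^ (\<alpha> i - 1)\<bar> \<le> 1" using xi \<open>h \<le> 1\<close> by (simp add: power_le_one)
    then show "\<bar>dU i\<bar> \<le> real (\<alpha> i)" by (simp add: dU_def abs_mult mult_left_le)
  qed
  then obtain D where D: "((\<lambda>s. monomial r \<alpha> (x(i := s))) has_real_derivative D) (at (x i))"
      "\<bar>d' - D\<bar> \<le> (3 ^ ?L - 1) / 3 * (1 / 2 ^ m) * real (\<alpha> i)"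
    using prod_power_input[of r \<alpha>] \<open>r \<ge> 2\<close> by auto
  have "\<bar>d\<bar> = \<bar>d' - D\<bar>" using DERIV_imp_deriv[OF D(1)] d'(1) by (simp add: pderiv_at_def)
  also have "\<dots> \<le> (3 ^ ?L - 1) / 3 * (1 / 2 ^ m) * real (\<alpha> i)" by (rule D(2))
  also have "\<dots> \<le> 3 ^ (?L - 1) * (1 / 2 ^ m) * real (\<Sum>j=1..r. \<alpha> j)"
  proof (intro mult_mono)
    have "(3 :: real) ^ ?L = 3 * 3 ^ (?L - 1)"
      using ceil_log2_pos[OF \<open>r \<ge> 2\<close>] by (metis Suc_diff_1 less_le_trans power_Suc zero_less_one)
    then show "((3 :: real) ^ ?L - 1) / 3 \<le> 3 ^ (?L - 1)" by simp
    show "real (\<alpha> i) \<le> real (\<Sum>j=1..r. \<alpha> j)"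
      using member_le_sum[of i "{1..r}" \<alpha>] i by (simp only: of_nat_le_iff) simp
  qed auto
  finally show ?thesis by (simp add: mult_ac)
qed

theorem lemma2p2:
  fixes m r :: nat and \<alpha> :: "nat \<Rightarrow> nat" and h :: real
  assumes "m \<ge> 1" and "r \<ge> 2"
    and "h \<le> 1 - real (ceil_log2 r) * (1 / 2 ^ m)"
  shows "(\<forall>x\<in>cube r h. 0 \<le> monomial_net m r \<alpha> x \<and> monomial_net m r \<alpha> x \<le> 1)
       \<and> (\<forall>x\<in>cube r h. 0 \<le> monomial_net m r \<alpha> x - monomial r \<alpha> x \<and>
            monomial_net m r \<alpha> x - monomial r \<alpha> x \<le> 3 ^ (ceil_log2 r - 1) * (1 / 2 ^ m))
       \<and> (\<forall>i\<in>{1..r}.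
            (SUP x\<in>cube r h. SUP d\<in>error_pderivs m r \<alpha> i x. ereal \<bar>d\<bar>)
              \<le> ereal (3 ^ (ceil_log2 r - 1) * real (\<Sum>j=1..r. \<alpha> j) * (1 / 2 ^ m)))"
proof -
  have "0 \<le> real (ceil_log2 r) * (1 / 2 ^ m)" by simp
  then have "h \<le> 1" using assms(3) by linarith
  note bounds = monomial_net_bounds[OF assms(2) this]
  have "0 \<le> monomial_net m r \<alpha> x" if "x \<in> cube r h" for x
    using bounds(1,2)[OF that, of \<alpha>] by (rule order_trans)
  \<comment> \<open>Suprema in the extended reals reduce to pointwise bounds, also for negative
    \<open>h\<close>, where the cube is empty.\<close>
  then show ?thesis
    using bounds(2,3,4) error_pderivs_bound[OF assms]
    by (intro conjI ballI SUP_least) (simp_all only: ereal_less_eq diff_ge_0_iff_ge)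
qed

end
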